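(* Let $G$ be a finite simple graph that is both $2K_2$-free and diamond-free, and let $\omega = \omega(G)$. Then $\chi(G) \leq \omega + 1$ if $\omega = 2$, and $\chi(G) \leq \omega$ if $\omega \geq 3$. Moreover, $G$ is perfect if $\omega \geq 4$.
   Context: A graph $G$ is $H$-free if $G$ contains no induced subgraph isomorphic to $H$. $2K_2$ is the disjoint union of two edges (four vertices, two disjoint edges, no other edges). The diamond is the graph obtained from $K_4$ by deleting one edge. $\chi(G)$ is the chromatic number and $\omega(G)$ the clique number of $G$. A graph is perfect if every induced subgraph $H$ satisfies $\chi(H) = \omega(H)$. *)

theory Defs
  imports Complex_Main "HOL-Library.Ramsey"
begin

text \<open>A graph is a pair of a vertex set and a set of edges, an edge being an unordered pair of
  distinct vertices; \<^term>\<open>nsets V 2\<close> is the set of all 2-element subsets of \<open>V\<close>, so loops and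
  multiple edges are excluded.  Cliques are those of \<open>HOL-Library.Ramsey\<close>.\<close>

type_synonym 'a graph = "'a set \<times> 'a set set"

abbreviation verts :: "'a graph \<Rightarrow> 'a set" where
  "verts \<equiv> fst"

abbreviation edges :: "'a graph \<Rightarrow> 'a set set" where
  "edges \<equiv> snd"

definition finite_simple_graph :: "'a graph \<Rightarrow> bool" where
  "finite_simple_graph G \<longleftrightarrow> finite (verts G) \<and> edges G \<subseteq> nsets (verts G) 2"

definition induced_subgraph :: "'a graph \<Rightarrow> 'a set \<Rightarrow> 'a graph" where
  "induced_subgraph G W = (W, {e \<in> edges G. e \<subseteq> W})"

definition isomorphic :: "'a graph \<Rightarrow> 'b graph \<Rightarrow> bool" where
  "isomorphic G H \<longleftrightarrow>
     (\<exists>f. bij_betw f (verts G) (verts H) \<and>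
          (\<forall>x\<in>verts G. \<forall>y\<in>verts G. {x, y} \<in> edges G \<longleftrightarrow> {f x, f y} \<in> edges H))"

definition free_of :: "'b graph \<Rightarrow> 'a graph \<Rightarrow> bool" where
  "free_of H G \<longleftrightarrow> \<not> (\<exists>W \<subseteq> verts G. isomorphic (induced_subgraph G W) H)"

definition two_K2 :: "nat graph" where
  "two_K2 = ({0, 1, 2, 3}, {{0, 1}, {2, 3}})"

definition diamond :: "nat graph" where
  "diamond = ({0, 1, 2, 3}, nsets {0, 1, 2, 3} 2 - {{0, 1}})"

text \<open>The maximum exists for finite graphs (the empty set is a clique); the graph without vertices
  has clique number and chromatic number 0.\<close>

definition clique_number :: "'a graph \<Rightarrow> nat" where
  "clique_number G = Max (card ` {K. K \<subseteq> verts G \<and> clique K (edges G)})"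

definition proper_colouring :: "'a graph \<Rightarrow> nat \<Rightarrow> ('a \<Rightarrow> nat) \<Rightarrow> bool" where
  "proper_colouring G k c \<longleftrightarrow>
     (\<forall>x\<in>verts G. c x < k) \<and> (\<forall>x\<in>verts G. \<forall>y\<in>verts G. {x, y} \<in> edges G \<longrightarrow> c x \<noteq> c y)"

definition chromatic_number :: "'a graph \<Rightarrow> nat" where
  "chromatic_number G = (LEAST k. \<exists>c. proper_colouring G k c)"

definition perfect :: "'a graph \<Rightarrow> bool" where
  "perfect G \<longleftrightarrow>
     (\<forall>W \<subseteq> verts G. chromatic_number (induced_subgraph G W) = clique_number (induced_subgraph G W))"

end

theory Submission
  imports Defs
begin

text \<open>If \<open>\<omega> = 2\<close>, an edge \<open>uv\<close> partitions the vertices into the stable sets \<open>N(u)\<close>, \<open>N(v)\<close> and the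
  common non-neighbours.  In general, let \<open>K\<close> be a maximum clique.  By diamond-freeness a vertex
  outside \<open>K\<close> has at most one neighbour in \<open>K\<close>, and by \<open>2K\<^sub>2\<close>-freeness an edge outside \<open>K\<close> must send
  an edge to every edge of \<open>K\<close>.  If \<open>\<omega> = 3\<close>, adjacent vertices outside \<open>K\<close> therefore have different
  neighbours in \<open>K\<close>, and one colours a vertex attached to \<open>k\<^sub>i\<close> like \<open>k\<^sub>i\<^sub>+\<^sub>1\<close>, indices modulo 3.  If
  \<open>\<omega> \<ge> 4\<close>, there is no edge outside \<open>K\<close> at all, so \<open>G\<close> is a split graph, hence perfect.\<close>

section \<open>Edges and the two forbidden induced subgraphs\<close>

lemma edge_distinct:
  assumes "finite_simple_graph G" "{x, y} \<in> edges G"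
  shows "x \<in> verts G" "y \<in> verts G" "x \<noteq> y"
  using assms by (auto simp: finite_simple_graph_def nsets_def)

lemma doubleton_in_nsets_2: "{x, y} \<in> nsets A 2 \<longleftrightarrow> x \<in> A \<and> y \<in> A \<and> x \<noteq> y"
  by (auto simp: nsets_def card_2_iff)

text \<open>Otherwise the four vertices induce \<open>two_K2\<close>. They are then distinct: if
  \<open>a = c\<close>, say, then \<open>{a, d}\<close> is the edge \<open>{c, d}\<close>.\<close>

lemma two_K2_freeD:
  assumes G: "finite_simple_graph G" and free: "free_of two_K2 G"
    and ab: "{a, b} \<in> edges G" and cd: "{c, d} \<in> edges G"
  shows "{a, c} \<in> edges G \<or> {a, d} \<in> edges G \<or> {b, c} \<in> edges G \<or> {b, d} \<in> edges G"
proof (rule ccontr)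
  assume non: "\<not> ?thesis"
  \<comment> \<open>Isomorphism also quantifies over \<open>x = y\<close>, where
    \<open>{x, y}\<close> collapses to a singleton.\<close>
  have loop: "{x} \<notin> edges G" for x
    using edge_distinct(3)[OF G, of x x] by auto
  have dist: "a \<noteq> b" "c \<noteq> d" "a \<noteq> c" "a \<noteq> d" "b \<noteq> c" "b \<noteq> d"
    using non ab cd edge_distinct(3)[OF G] by (auto simp: insert_commute)
  define f where "f = (\<lambda>x. if x = a then 0 else if x = b then 1 else if x = c then 2 else 3 :: nat)"
  have f: "f a = 0" "f b = 1" "f c = 2" "f d = 3"
    using dist by (auto simp: f_def)
  have "isomorphic (induced_subgraph G {a, b, c, d}) two_K2"
    unfolding isomorphic_def
  proof (intro exI conjI)
    show "bij_betw f (verts (induced_subgraph G {a, b, c, d})) (verts two_K2)"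
      by (auto simp: bij_betw_def inj_on_def induced_subgraph_def two_K2_def f)
    show "\<forall>x\<in>verts (induced_subgraph G {a, b, c, d}). \<forall>y\<in>verts (induced_subgraph G {a, b, c, d}).
      {x, y} \<in> edges (induced_subgraph G {a, b, c, d}) \<longleftrightarrow> {f x, f y} \<in> edges two_K2"
      using non ab cd loop
      by (auto simp: induced_subgraph_def two_K2_def f doubleton_eq_iff insert_commute)
  qed
  moreover have "{a, b, c, d} \<subseteq> verts G"
    using edge_distinct[OF G ab] edge_distinct[OF G cd] by auto
  ultimately show False
    using free by (auto simp: free_of_def)
qed

text \<open>Otherwise the four vertices induce a diamond, \<open>a\<close> and \<open>b\<close>
  playing its non-adjacent vertices 0 and 1. Every other pair is distinct because it is joined by an
  edge.\<close>

lemma diamond_freeD: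
  assumes G: "finite_simple_graph G" and free: "free_of diamond G" and "a \<noteq> b"
    and E: "{a, c} \<in> edges G" "{a, d} \<in> edges G" "{b, c} \<in> edges G" "{b, d} \<in> edges G"
      "{c, d} \<in> edges G"
  shows "{a, b} \<in> edges G"
proof (rule ccontr)
  assume non: "{a, b} \<notin> edges G"
  have loop: "{x} \<notin> edges G" for x
    using edge_distinct(3)[OF G, of x x] by auto
  have dist: "a \<noteq> b" "c \<noteq> d" "a \<noteq> c" "a \<noteq> d" "b \<noteq> c" "b \<noteq> d"
    using assms(3) E edge_distinct(3)[OF G] by auto
  define f where "f = (\<lambda>x. if x = a then 0 else if x = b then 1 else if x = c then 2 else 3 :: nat)"
  have f: "f a = 0" "f b = 1" "f c = 2" "f d = 3"
    using dist by (auto simp: f_def)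
  have "isomorphic (induced_subgraph G {a, b, c, d}) diamond"
    unfolding isomorphic_def
  proof (intro exI conjI)
    show "bij_betw f (verts (induced_subgraph G {a, b, c, d})) (verts diamond)"
      by (auto simp: bij_betw_def inj_on_def induced_subgraph_def diamond_def f)
    show "\<forall>x\<in>verts (induced_subgraph G {a, b, c, d}). \<forall>y\<in>verts (induced_subgraph G {a, b, c, d}).
      {x, y} \<in> edges (induced_subgraph G {a, b, c, d}) \<longleftrightarrow> {f x, f y} \<in> edges diamond"
      using non E loop
      by (auto simp: induced_subgraph_def diamond_def f doubleton_in_nsets_2 doubleton_eq_iff
          insert_commute nsets_def)
  qed
  moreover have "{a, b, c, d} \<subseteq> verts G"
    using edge_distinct[OF G E(1)] edge_distinct[OF G E(4)] by auto
  ultimately show False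
    using free by (auto simp: free_of_def)
qed

section \<open>Clique number and chromatic number\<close>

lemma card_clique_le_clique_number:
  assumes "finite (verts G)" "K \<subseteq> verts G" "clique K (edges G)"
  shows "card K \<le> clique_number G"
  unfolding clique_number_def using assms by (intro Max_ge) auto

lemma maximum_clique_exists:
  assumes "finite (verts G)"
  obtains K where "K \<subseteq> verts G" "clique K (edges G)" "card K = clique_number G"
proof -
  have "clique_number G \<in> card ` {K. K \<subseteq> verts G \<and> clique K (edges G)}"
    unfolding clique_number_def
  proof (rule Max_in)
    show "card ` {K. K \<subseteq> verts G \<and> clique K (edges G)} \<noteq> {}"
      by (auto intro!: exI[of _ "{}"] simp: clique_def)
  qed (use assms in auto)
  then show ?thesis
    using that by auto
qed

lemma chromatic_number_le:
  "proper_colouring G k c \<Longrightarrow> chromatic_number G \<le> k"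
  unfolding chromatic_number_def by (rule Least_le) blast

text \<open>The \<open>LEAST\<close> is attained because some colouring exists: give all vertices
  different colours.\<close>

lemma proper_colouring_of_chromatic_number:
  fixes G :: "'a graph"
  assumes "finite_simple_graph G"
  obtains c where "proper_colouring G (chromatic_number G) c"
proof -
  obtain h :: "'a \<Rightarrow> nat" and n where "h ` verts G = {i. i < n}" "inj_on h (verts G)"
    using assms finite_imp_inj_to_nat_seg by (metis finite_simple_graph_def)
  then have "proper_colouring G n h"
    using edge_distinct(3)[OF assms] unfolding proper_colouring_def inj_on_def by blast
  then have "\<exists>c. proper_colouring G n c" by blast
  then have "\<exists>c. proper_colouring G (chromatic_number G) c"
    unfolding chromatic_number_def by (rule LeastI)
  then show ?thesis
    using that by blast
qed

lemma clique_number_le_chromatic_number: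
  assumes "finite_simple_graph G"
  shows "clique_number G \<le> chromatic_number G"
proof -
  obtain c where c: "proper_colouring G (chromatic_number G) c"
    using proper_colouring_of_chromatic_number[OF assms] .
  obtain K where K: "K \<subseteq> verts G" "clique K (edges G)" "card K = clique_number G"
    using maximum_clique_exists assms by (metis finite_simple_graph_def)
  have "inj_on c K"
    using K c unfolding proper_colouring_def clique_def inj_on_def by (meson subsetD)
  moreover have "c ` K \<subseteq> {..<chromatic_number G}"
    using K c by (auto simp: proper_colouring_def)
  ultimately have "card K \<le> card {..<chromatic_number G}"
    by (metis card_inj_on_le finite_lessThan)
  then show ?thesis
    using K by simp
qed

section \<open>Split graphs are perfect\<close>

lemma finite_simple_induced_subgraph:
  assumes "finite_simple_graph G" "W \<subseteq> verts G"
  shows "finite_simple_graph (induced_subgraph G W)"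
  using assms finite_subset
  by (fastforce simp: finite_simple_graph_def induced_subgraph_def nsets_def)

text \<open>If a vertex outside \<open>K\<close> is adjacent to all of \<open>K\<close>, it enlarges
  the clique, which pays for one extra colour on the stable set. Otherwise each outside vertex
  reuses the colour of a non-neighbour in \<open>K\<close>.\<close>

lemma split_graph_chromatic_number:
  assumes G: "finite_simple_graph G" and K: "clique K (edges G)" "K \<subseteq> verts G"
    and stable: "\<And>x y. \<lbrakk>x \<in> verts G - K; y \<in> verts G - K\<rbrakk> \<Longrightarrow> {x, y} \<notin> edges G"
  shows "chromatic_number G = clique_number G"
proof (rule antisym)
  have fin: "finite (verts G)" "finite K"
    using G K finite_subset by (auto simp: finite_simple_graph_def)
  then obtain h where h: "bij_betw h K {0..<card K}"
    using ex_bij_betw_finite_nat by blast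
  have hlt: "h v < card K" if "v \<in> K" for v
    using h that by (auto simp: bij_betw_def)
  have hinj: "h x \<noteq> h y" if "x \<in> K" "y \<in> K" "{x, y} \<in> edges G" for x y
    using h that edge_distinct(3)[OF G] by (metis bij_betw_def inj_on_eq_iff)
  show "chromatic_number G \<le> clique_number G"
  proof (cases "\<exists>s\<in>verts G - K. \<forall>k\<in>K. {s, k} \<in> edges G")
    case True
    then obtain s where s: "s \<in> verts G - K" "\<forall>k\<in>K. {s, k} \<in> edges G" ..
    have "clique (insert s K) (edges G)"
      using K s by (auto simp: clique_def insert_commute)
    then have "card (insert s K) \<le> clique_number G"
      using K s fin by (intro card_clique_le_clique_number) auto
    then have "Suc (card K) \<le> clique_number G"
      using s fin by simp
    moreover have "proper_colouring G (Suc (card K)) (\<lambda>v. if v \<in> K then h v else card K)"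
      using hlt hinj stable by (fastforce simp: proper_colouring_def less_Suc_eq)
    ultimately show ?thesis
      using chromatic_number_le order_trans by blast
  next
    case False
    then obtain t where t: "\<And>s. s \<in> verts G - K \<Longrightarrow> t s \<in> K \<and> {s, t s} \<notin> edges G"
      by metis
    define c where "c = (\<lambda>v. h (if v \<in> K then v else t v))"
    \<comment> \<open>Since \<open>h\<close> is injective on \<open>K\<close>, the only vertex of
      \<open>K\<close> sharing the colour of \<open>x\<close> is its non-neighbour
      \<open>t x\<close>.\<close>
    have "h (t x) \<noteq> h y" if "x \<in> verts G - K" "y \<in> K" "{x, y} \<in> edges G" for x y
      using t[OF that(1)] that h by (metis bij_betw_def inj_on_eq_iff)
    then have "proper_colouring G (card K) c"
      unfolding proper_colouring_def c_def using hlt hinj stable t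
      by (smt (verit) DiffI insert_commute)
    then show ?thesis
      using chromatic_number_le card_clique_le_clique_number[OF fin(1) K(2,1)] order_trans by blast
  qed
  show "clique_number G \<le> chromatic_number G"
    by (rule clique_number_le_chromatic_number[OF G])
qed

text \<open>Being split passes to induced subgraphs: \<open>W\<close> splits into the clique
  \<open>K \<inter> W\<close> and the stable rest.\<close>

lemma split_graph_perfect:
  assumes G: "finite_simple_graph G" and K: "clique K (edges G)"
    and stable: "\<And>x y. \<lbrakk>x \<in> verts G - K; y \<in> verts G - K\<rbrakk> \<Longrightarrow> {x, y} \<notin> edges G"
  shows "perfect G"
  unfolding perfect_def
proof (intro allI impI)
  fix W assume W: "W \<subseteq> verts G"
  show "chromatic_number (induced_subgraph G W) = clique_number (induced_subgraph G W)"
  proof (rule split_graph_chromatic_number[where K = "K \<inter> W"])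
    show "clique (K \<inter> W) (edges (induced_subgraph G W))"
      using K by (auto simp: clique_def induced_subgraph_def)
  qed (use W stable finite_simple_induced_subgraph[OF G W] in
      \<open>auto simp: induced_subgraph_def\<close>)
qed

lemma perfect_chromatic_number:
  assumes "finite_simple_graph G" "perfect G"
  shows "chromatic_number G = clique_number G"
proof -
  have "induced_subgraph G (verts G) = G"
    using assms(1)
    by (cases G) (auto simp: finite_simple_graph_def induced_subgraph_def nsets_def)
  then show ?thesis
    using assms(2) unfolding perfect_def by (metis order_refl)
qed

section \<open>Maximum cliques and the cases of the theorem\<close>

text \<open>For any further \<open>c\<close> in \<open>K\<close>, the vertices \<open>v\<close> and
  \<open>c\<close> have the adjacent common neighbours \<open>a\<close> and \<open>b\<close>, so
  they are adjacent. Then \<open>v\<close> extends \<open>K\<close>, against maximality.\<close>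

lemma unique_neighbour_in_maximum_clique:
  assumes G: "finite_simple_graph G" and free: "free_of diamond G"
    and K: "K \<subseteq> verts G" "clique K (edges G)" "card K = clique_number G"
    and v: "v \<notin> K" and ab: "a \<in> K" "b \<in> K" "{v, a} \<in> edges G" "{v, b} \<in> edges G"
  shows "a = b"
proof (rule ccontr)
  assume "a \<noteq> b"
  have fin: "finite (verts G)" "finite K"
    using G K finite_subset by (auto simp: finite_simple_graph_def)
  have KE: "{x, y} \<in> edges G" if "x \<in> K" "y \<in> K" "x \<noteq> y" for x y
    using K that by (auto simp: clique_def)
  have "{v, c} \<in> edges G" if "c \<in> K" for c
  proof (cases "c = a \<or> c = b")
    case False
    then show ?thesis
      using diamond_freeD[OF G free, of v c a b] v ab that KE \<open>a \<noteq> b\<close> by metis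
  qed (use ab in auto)
  then have "clique (insert v K) (edges G)"
    using KE by (auto simp: clique_def insert_commute)
  then have "card (insert v K) \<le> clique_number G"
    using K edge_distinct[OF G ab(3)] fin by (intro card_clique_le_clique_number) auto
  then show False
    using v K fin by simp
qed

lemma chromatic_number_le_3_if_clique_number_2:
  assumes G: "finite_simple_graph G" and free: "free_of two_K2 G" and 2: "clique_number G = 2"
  shows "chromatic_number G \<le> 3"
proof -
  have fin: "finite (verts G)"
    using G by (simp add: finite_simple_graph_def)
  obtain K where K: "K \<subseteq> verts G" "clique K (edges G)" "card K = 2"
    using maximum_clique_exists[OF fin] 2 by metis
  then obtain u v where "K = {u, v}" "u \<noteq> v"
    by (auto simp: card_2_iff)
  then have uv: "{u, v} \<in> edges G"
    using K by (auto simp: clique_def)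
  have triangle: False if "{x, y} \<in> edges G" "{x, z} \<in> edges G" "{y, z} \<in> edges G" for x y z
  proof -
    have "card {x, y, z} \<le> clique_number G"
      using that edge_distinct[OF G] fin
      by (intro card_clique_le_clique_number) (auto simp: clique_def insert_commute)
    moreover have "x \<noteq> y" "x \<noteq> z" "y \<noteq> z"
      using that edge_distinct(3)[OF G] by auto
    ultimately show False
      using 2 by simp
  qed
  \<comment> \<open>The ends of the edge need no special case: \<open>u\<close> gets 0 and
    \<open>v\<close> gets 1. Classes 0 and 1 are stable for lack of triangles; an edge inside class
    2 would form a \<open>two_K2\<close> with \<open>uv\<close>.\<close>
  define c where "c = (\<lambda>x. if {x, v} \<in> edges G then 0 else if {x, u} \<in> edges G then 1 else 2 :: nat)"
  have "c x \<noteq> c y" if "{x, y} \<in> edges G" for x y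
    using that triangle[of x y v] triangle[of x y u] two_K2_freeD[OF G free that uv]
    by (auto simp: c_def)
  then have "proper_colouring G 3 c"
    by (auto simp: proper_colouring_def c_def)
  then show ?thesis
    by (rule chromatic_number_le)
qed

lemma chromatic_number_le_3_if_clique_number_3:
  assumes G: "finite_simple_graph G" and free: "free_of two_K2 G" "free_of diamond G"
    and 3: "clique_number G = 3"
  shows "chromatic_number G \<le> 3"
proof -
  obtain K where K: "K \<subseteq> verts G" "clique K (edges G)" "card K = clique_number G"
    using maximum_clique_exists G by (metis finite_simple_graph_def)
  then obtain p q r where pqr: "K = {p, q, r}" "p \<noteq> q" "q \<noteq> r" "p \<noteq> r"
    using 3 by (auto simp: card_3_iff)
  have KE: "{p, q} \<in> edges G" "{q, r} \<in> edges G" "{p, r} \<in> edges G"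
    using K pqr by (auto simp: clique_def)
  have unique: "\<not> ({x, p} \<in> edges G \<and> {x, q} \<in> edges G)"
    "\<not> ({x, p} \<in> edges G \<and> {x, r} \<in> edges G)" "\<not> ({x, q} \<in> edges G \<and> {x, r} \<in> edges G)"
    if "x \<notin> K" for x
    using unique_neighbour_in_maximum_clique[OF G free(2) K that] pqr by blast+
  \<comment> \<open>The last 0 serves vertices attached to \<open>r\<close> and also those without
    neighbours in \<open>K\<close>. The latter have no neighbour outside \<open>K\<close> either, as
    some edge of \<open>K\<close> would avoid the at most one attachment of that neighbour.\<close>
  define c where "c = (\<lambda>x. if x = p then 0 else if x = q then 1 else if x = r then 2
    else if {x, p} \<in> edges G then 1 else if {x, q} \<in> edges G then 2 else 0 :: nat)"
  \<comment> \<open>The attachments of \<open>x\<close> and \<open>y\<close> together meet all three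
    edges of \<open>K\<close>, hence include two of its vertices. Each has at most one, so they
    differ, and so do the colours.\<close>
  have out: "c x \<noteq> c y" if "{x, y} \<in> edges G" "x \<notin> K" "y \<notin> K" for x y
    using unique[OF that(2)] unique[OF that(3)] that pqr
      two_K2_freeD[OF G free(1) that(1) KE(1)] two_K2_freeD[OF G free(1) that(1) KE(2)]
      two_K2_freeD[OF G free(1) that(1) KE(3)]
    by (auto simp: c_def)
  have mix: "c x \<noteq> c y" if "{x, y} \<in> edges G" "x \<notin> K" "y \<in> K" for x y
    using unique[OF that(2)] that pqr by (auto simp: c_def)
  have inn: "c x \<noteq> c y" if "{x, y} \<in> edges G" "x \<in> K" "y \<in> K" for x y
    using that pqr edge_distinct(3)[OF G that(1)] by (auto simp: c_def)
  have "c x \<noteq> c y" if "{x, y} \<in> edges G" for x y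
    using out mix inn that by (metis insert_commute)
  then have "proper_colouring G 3 c"
    by (auto simp: proper_colouring_def c_def)
  then show ?thesis
    by (rule chromatic_number_le)
qed

lemma perfect_if_clique_number_ge_4:
  assumes G: "finite_simple_graph G" and free: "free_of two_K2 G" "free_of diamond G"
    and 4: "clique_number G \<ge> 4"
  shows "perfect G"
proof -
  obtain K where K: "K \<subseteq> verts G" "clique K (edges G)" "card K = clique_number G"
    using maximum_clique_exists G by (metis finite_simple_graph_def)
  have fin: "finite K"
    using G K finite_subset by (auto simp: finite_simple_graph_def)
  define N where "N = (\<lambda>x. {k \<in> K. {x, k} \<in> edges G})"
  have N: "card (N x) \<le> 1" if "x \<notin> K" for x
    using unique_neighbour_in_maximum_clique[OF G free(2) K that] fin
    by (auto simp: N_def card_le_Suc0_iff_eq)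
  have "{x, y} \<notin> edges G" if "x \<notin> K" "y \<notin> K" for x y
  proof
    assume xy: "{x, y} \<in> edges G"
    have "card (N x \<union> N y) \<le> 2"
      using N[OF that(1)] N[OF that(2)] card_Un_le[of "N x" "N y"] by linarith
    \<comment> \<open>Here \<open>\<omega> \<ge> 4\<close> enters: two vertices of \<open>K\<close>
      are left that neither \<open>x\<close> nor \<open>y\<close> sees, and their edge forms a
      \<open>two_K2\<close> with \<open>xy\<close>.\<close>
    then have "2 \<le> card (K - (N x \<union> N y))"
      using 4 K diff_card_le_card_Diff[of "N x \<union> N y" K] fin by (auto simp: N_def)
    then obtain a b where "a \<in> K - (N x \<union> N y)" "b \<in> K - (N x \<union> N y)" "a \<noteq> b"
      by (auto simp: numeral_2_eq_2 card_le_Suc_iff)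
    then show False
      using two_K2_freeD[OF G free(1) xy, of a b] K by (auto simp: N_def clique_def)
  qed
  then show ?thesis
    using split_graph_perfect[OF G K(2)] by blast
qed

theorem theorem4:
  fixes G :: "'a graph"
  assumes "finite_simple_graph G"
    and "free_of two_K2 G"
    and "free_of diamond G"
  shows "(clique_number G = 2 \<longrightarrow> chromatic_number G \<le> clique_number G + 1) \<and>
         (clique_number G \<ge> 3 \<longrightarrow> chromatic_number G \<le> clique_number G) \<and>
         (clique_number G \<ge> 4 \<longrightarrow> perfect G)"
proof (intro conjI impI)
  show "chromatic_number G \<le> clique_number G + 1" if "clique_number G = 2"
    using chromatic_number_le_3_if_clique_number_2[OF assms(1,2) that] that by simp
  show "perfect G" if "clique_number G \<ge> 4"
    by (rule perfect_if_clique_number_ge_4[OF assms that])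
  \<comment> \<open>Only \<open>\<omega> = 3\<close> needs the explicit colouring; above that,
    perfection gives equality.\<close>
  then show "chromatic_number G \<le> clique_number G" if "clique_number G \<ge> 3"
    using that chromatic_number_le_3_if_clique_number_3[OF assms]
      perfect_chromatic_number[OF assms(1)]
    by (cases "clique_number G = 3") auto
qed

end
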